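(* Let $n\ge 2$, let $X=\sum_{i=1}^n a_i\,\partial/\partial\theta_i$ be a constant vector field on $T^n$ whose coefficients $a_1,\dots,a_n\in\mathbb{R}$ are independent over $\mathbb{Q}$, and let $\phi$ be the flow on $T^n$ generated by $X$. Then $\nu_\phi:\Pi_\phi\to\rho_\phi(S_\phi)$ is an isomorphism of groups and $\Pi_\phi$ is an abelian subgroup of $\mathrm{GL}(n,\mathbb{Z})$.
   Context: $T^n=\mathbb{R}^n/\mathbb{Z}^n$ with coordinates $\theta_i=x_i\bmod 1$ and covering map $\pi:\mathbb{R}^n\to T^n$. $\mathrm{Diff}(T^n)$ is the group of $C^\infty$ diffeomorphisms of $T^n$. Real numbers $a_1,\dots,a_n$ are independent over $\mathbb{Q}$ if $\sum_j m_ja_j=0$ with $m_j\in\mathbb{Z}$ implies all $m_j=0$. For a flow $\phi$ generated by $X$, $F_\phi=\{\phi_t:t\in\mathbb{R}\}$ and $S_\phi$ is the normalizer of $F_\phi$ in $\mathrm{Diff}(T^n)$. For $R\in\mathrm{Diff}(T^n)$, $R_*X=\mathbf{T}R\circ X\circ R^{-1}$, where $\mathbf{T}$ is the tangent functor. It is known that $R\in S_\phi$ if and only if there is a unique $\alpha\in\mathbb{R}^*=\mathbb{R}\setminus\{0\}$ with $R_*X=\alpha X$ (equivalently $R\phi_t=\phi_{\alpha t}R$ for all $t$); the homomorphism $\rho_\phi:S_\phi\to\mathbb{R}^*$ sends $R$ to this $\alpha$. A lift of $R$ is a continuous $\hat R:\mathbb{R}^n\to\mathbb{R}^n$ with $R\pi=\pi\hat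 R$; any two lifts differ by translation by an element of $\mathbb{Z}^n$. Define $\Pi_\phi=\{B\in\mathrm{GL}(n,\mathbb{Z}): B=\mathbf{T}\hat R \text{ for an } R\in S_\phi\}$, where $\mathbf{T}\hat R=B$ means that the derivative of the lift $\hat R$ is the constant matrix $B$. The map $\nu_\phi$ is given by $\nu_\phi(B)=\rho_\phi(R)$ where $R\in S_\phi$ with $\mathbf{T}\hat R=B$ (this is well-defined under the stated hypotheses). *)

theory Defs
  imports "HOL-Analysis.Analysis" "HOL-Algebra.Group_Action"
begin

section \<open>The torus\<close>

quotient_type (overloaded) 'n torus = "real ^ 'n::finite" /
  "\<lambda>x y. \<forall>i. x $ i - y $ i \<in> \<int>"
proof (rule equivpI)
  show "reflp (\<lambda>x y :: real ^ 'n. \<forall>i. x $ i - y $ i \<in> \<int>)"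
    by (simp add: reflp_def)
  show "symp (\<lambda>x y :: real ^ 'n. \<forall>i. x $ i - y $ i \<in> \<int>)"
    unfolding symp_def by (metis Ints_minus minus_diff_eq)
  show "transp (\<lambda>x y :: real ^ 'n. \<forall>i. x $ i - y $ i \<in> \<int>)"
    unfolding transp_def
  proof (intro allI impI)
    fix x y z :: "real ^ 'n" and i
    assume "\<forall>i. x $ i - y $ i \<in> \<int>" "\<forall>i. y $ i - z $ i \<in> \<int>"
    then have "(x $ i - y $ i) + (y $ i - z $ i) \<in> \<int>" by (intro Ints_add) auto
    then show "x $ i - z $ i \<in> \<int>" by simp
  qed
qed

lift_definition torus_proj :: "real ^ 'n::finite \<Rightarrow> 'n torus" is "\<lambda>x. x" .


section \<open>Smooth maps of the torus\<close>

text \<open>For open sets in Euclidean spaces this is the usual \<open>C\<^sup>k\<close>: all iterated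
  directional derivatives up to order \<open>k\<close> exist and are continuous.\<close>

fun Ck_on :: "nat \<Rightarrow> ('a::euclidean_space \<Rightarrow> 'b::euclidean_space) \<Rightarrow> 'a set \<Rightarrow> bool" where
  "Ck_on 0 f U \<longleftrightarrow> continuous_on U f"
| "Ck_on (Suc k) f U \<longleftrightarrow>
     (\<forall>x\<in>U. f differentiable (at x)) \<and>
     (\<forall>v. Ck_on k (\<lambda>x. frechet_derivative f (at x) v) U)"

text \<open>The charts of the torus are the local inverses of \<^const>\<open>torus_proj\<close>, so \<open>G\<close> below is
  an expression of \<open>R\<close> in charts on the open set \<open>U\<close>.\<close>

definition local_rep :: "('n::finite torus \<Rightarrow> 'n torus) \<Rightarrow> (real ^ 'n) set \<Rightarrow>
    (real ^ 'n \<Rightarrow> real ^ 'n) \<Rightarrow> bool" where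
  "local_rep R U G \<longleftrightarrow> open U \<and> (\<forall>y\<in>U. R (torus_proj y) = torus_proj (G y))"

definition smooth_torus_map :: "('n::finite torus \<Rightarrow> 'n torus) \<Rightarrow> bool" where
  "smooth_torus_map R \<longleftrightarrow> (\<forall>x. \<exists>U G. x \<in> U \<and> local_rep R U G \<and> (\<forall>k. Ck_on k G U))"

definition Diff_torus :: "('n::finite torus \<Rightarrow> 'n torus) monoid" where
  "Diff_torus =
     \<lparr>carrier = {R. bij R \<and> smooth_torus_map R \<and> smooth_torus_map (inv_into UNIV R)},
      mult = (\<circ>), one = id\<rparr>"

text \<open>Tangent vectors are written in the global frame \<open>\<partial>/\<partial>\<theta>\<^sub>i\<close>: a tangent vector at a point of
  the torus is an element of \<open>\<real>\<^sup>n\<close>, and a vector field is a map from the torus to \<open>\<real>\<^sup>n\<close>. The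
  derivative of a local representative at \<open>x\<close> depends only on \<open>R\<close> and on \<open>torus_proj x\<close>.\<close>

definition torus_tangent :: "('n::finite torus \<Rightarrow> 'n torus) \<Rightarrow> 'n torus \<Rightarrow>
    real ^ 'n \<Rightarrow> real ^ 'n" where
  "torus_tangent R p = (THE L. \<exists>x U G. torus_proj x = p \<and> x \<in> U \<and> local_rep R U G \<and>
                                     (G has_derivative L) (at x))"

definition push_forward :: "('n::finite torus \<Rightarrow> 'n torus) \<Rightarrow> ('n torus \<Rightarrow> real ^ 'n) \<Rightarrow>
    ('n torus \<Rightarrow> real ^ 'n)" where
  "push_forward R X p = torus_tangent R (inv_into UNIV R p) (X (inv_into UNIV R p))"


section \<open>Flows\<close>

definition has_torus_velocity :: "(real \<Rightarrow> 'n::finite torus) \<Rightarrow> real ^ 'n \<Rightarrow> real \<Rightarrow> bool" where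
  "has_torus_velocity c v t \<longleftrightarrow>
     (\<exists>\<gamma>. (\<forall>\<^sub>F s in nhds t. c s = torus_proj (\<gamma> s)) \<and> (\<gamma> has_vector_derivative v) (at t))"

definition generates_flow :: "('n::finite torus \<Rightarrow> real ^ 'n) \<Rightarrow>
    (real \<Rightarrow> 'n torus \<Rightarrow> 'n torus) \<Rightarrow> bool" where
  "generates_flow X \<phi> \<longleftrightarrow>
     \<phi> 0 = id \<and> (\<forall>s t. \<phi> (s + t) = \<phi> s \<circ> \<phi> t) \<and>
     (\<forall>p t. has_torus_velocity (\<lambda>s. \<phi> s p) (X (\<phi> t p)) t)"

text \<open>A flow has at most one generator, namely its velocity field at time 0.\<close>

definition flow_generator :: "(real \<Rightarrow> 'n::finite torus \<Rightarrow> 'n torus) \<Rightarrow> 'n torus \<Rightarrow> real ^ 'n" where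
  "flow_generator \<phi> = (THE X. generates_flow X \<phi>)"

definition F_flow :: "(real \<Rightarrow> 'n::finite torus \<Rightarrow> 'n torus) \<Rightarrow> ('n torus \<Rightarrow> 'n torus) set" where
  "F_flow \<phi> = range \<phi>"

definition S_flow :: "(real \<Rightarrow> 'n::finite torus \<Rightarrow> 'n torus) \<Rightarrow> ('n torus \<Rightarrow> 'n torus) set" where
  "S_flow \<phi> = normalizer Diff_torus (F_flow \<phi>)"

definition rho_flow :: "(real \<Rightarrow> 'n::finite torus \<Rightarrow> 'n torus) \<Rightarrow> ('n torus \<Rightarrow> 'n torus) \<Rightarrow> real" where
  "rho_flow \<phi> R =
     (THE \<alpha>. \<alpha> \<noteq> 0 \<and> push_forward R (flow_generator \<phi>) = (\<lambda>p. \<alpha> *\<^sub>R flow_generator \<phi> p))"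

definition mult_group_real :: "real monoid" where
  "mult_group_real = \<lparr>carrier = UNIV - {0}, mult = (*), one = 1\<rparr>"


section \<open>Linear parts of lifts\<close>

definition GL_int :: "(int ^ 'n::finite ^ 'n) monoid" where
  "GL_int = \<lparr>carrier = {B. invertible B}, mult = (**), one = mat 1\<rparr>"

definition is_lift :: "('n::finite torus \<Rightarrow> 'n torus) \<Rightarrow> (real ^ 'n \<Rightarrow> real ^ 'n) \<Rightarrow> bool" where
  "is_lift R Rh \<longleftrightarrow> continuous_on UNIV Rh \<and> R \<circ> torus_proj = torus_proj \<circ> Rh"

definition lift_derivative_is :: "('n::finite torus \<Rightarrow> 'n torus) \<Rightarrow> int ^ 'n ^ 'n \<Rightarrow> bool" where
  "lift_derivative_is R B \<longleftrightarrow>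
     (\<exists>Rh. is_lift R Rh \<and> (\<forall>x. (Rh has_derivative (*v) (map_matrix real_of_int B)) (at x)))"

definition Pi_flow :: "(real \<Rightarrow> 'n::finite torus \<Rightarrow> 'n torus) \<Rightarrow> (int ^ 'n ^ 'n) set" where
  "Pi_flow \<phi> = {B \<in> carrier GL_int. \<exists>R \<in> S_flow \<phi>. lift_derivative_is R B}"

definition nu_flow :: "(real \<Rightarrow> 'n::finite torus \<Rightarrow> 'n torus) \<Rightarrow> int ^ 'n ^ 'n \<Rightarrow> real" where
  "nu_flow \<phi> B = (THE r. \<exists>R \<in> S_flow \<phi>. lift_derivative_is R B \<and> r = rho_flow \<phi> R)"

definition rationally_independent :: "real ^ 'n::finite \<Rightarrow> bool" where
  "rationally_independent a \<longleftrightarrow>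
     (\<forall>m :: 'n \<Rightarrow> int. (\<Sum>j\<in>UNIV. real_of_int (m j) * a $ j) = 0 \<longrightarrow> (\<forall>j. m j = 0))"

end

theory Submission
  imports Defs
begin

text \<open>A diffeomorphism \<open>R\<close> normalizing the flow carries each \<open>\<phi>\<^sub>t\<close> to some \<open>\<phi>\<^sub>s\<close>, so for every \<open>z\<close>
  the difference \<open>R (p + z) - R p\<close> is constant along orbits, hence constant because the orbits are
  dense (Kronecker). Thus \<open>R - R 0\<close> is a homomorphism of the torus, which the derivative \<open>B\<close> of \<open>R\<close> at
  \<open>0\<close> lifts linearly: the normalizer consists of the affine maps \<open>x \<mapsto> B x + c\<close> with
  \<open>B \<in> GL(n,\<int>)\<close> and \<open>B a = \<alpha> a\<close>, and \<open>\<rho>\<close> and \<open>\<nu>\<close> read off the eigenvalue \<open>\<alpha>\<close>. Rational independence of \<open>a\<close>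
  makes an integer matrix determined by its value at \<open>a\<close>, so \<open>\<nu>\<close> embeds \<open>\<Pi>\<close> in the abelian group
  \<open>\<real>\<^sup>*\<close>.\<close>

section \<open>The integer lattice\<close>

definition integer_lattice :: "(real ^ 'n::finite) set" where
  "integer_lattice = {x. \<forall>i. x $ i \<in> \<int>}"

lemma torus_proj_eq_iff: "torus_proj x = torus_proj y \<longleftrightarrow> x - y \<in> integer_lattice"
  unfolding integer_lattice_def by transfer simp

lemma torus_proj_cases: obtains x where "p = torus_proj x"
  using torus.abs_induct[of "\<lambda>p. \<exists>x. p = torus_proj x"] unfolding torus_proj.abs_eq by blast

lemma lattice_zero [simp]: "0 \<in> integer_lattice"
  by (simp add: integer_lattice_def)

lemma lattice_add: "x \<in> integer_lattice \<Longrightarrow> y \<in> integer_lattice \<Longrightarrow> x + y \<in> integer_lattice"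
  by (simp add: integer_lattice_def)

lemma lattice_diff: "x \<in> integer_lattice \<Longrightarrow> y \<in> integer_lattice \<Longrightarrow> x - y \<in> integer_lattice"
  by (simp add: integer_lattice_def)

lemma closed_integer_lattice: "closed (integer_lattice :: (real ^ 'n::finite) set)"
proof -
  have "closed ((\<lambda>x :: real ^ 'n. x $ i) -` \<int>)" for i
    by (intro closed_vimage closed_Ints continuous_intros)
  then have "closed (\<Inter>i. (\<lambda>x :: real ^ 'n. x $ i) -` \<int>)"
    by (intro closed_INT) auto
  also have "(\<Inter>i. (\<lambda>x :: real ^ 'n. x $ i) -` \<int>) = integer_lattice"
    by (auto simp: integer_lattice_def)
  finally show ?thesis .
qed

lemma lattice_norm_less_one:
  assumes "x \<in> integer_lattice" "norm x < 1"
  shows "x = 0"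
proof -
  have "x $ i = 0" for i
    using assms component_le_norm_cart[of x i] Ints_nonzero_abs_less1[of "x $ i"]
    by (force simp: integer_lattice_def)
  then show ?thesis by (simp add: vec_eq_iff)
qed

section \<open>Limits, local constancy and derivatives modulo the lattice\<close>

lemma lattice_limit:
  assumes "(f \<longlongrightarrow> l) F" "\<forall>\<^sub>F x in F. f x \<in> integer_lattice" "F \<noteq> bot"
  shows "l \<in> integer_lattice"
  using Lim_in_closed_set[OF closed_integer_lattice assms(2,3,1)] .

text \<open>Distinct lattice points are at distance at least 1. Continuity at \<open>x\<close> alone
  suffices, which suits chart expressions known to be differentiable at one point.\<close>

lemma continuous_into_lattice_locally_constant:
  assumes "isCont f x" "\<forall>\<^sub>F y in nhds x. f y \<in> integer_lattice"
  shows "\<forall>\<^sub>F y in nhds x. f y = f x"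
proof -
  have "(f \<longlongrightarrow> f x) (nhds x)"
    using assms(1) unfolding isCont_def tendsto_at_iff_tendsto_nhds .
  then have "\<forall>\<^sub>F y in nhds x. dist (f y) (f x) < 1"
    by (rule tendstoD) simp
  with assms(2) show ?thesis
  proof eventually_elim
    case (elim y)
    then show ?case
      using lattice_norm_less_one[OF lattice_diff[OF elim(1) eventually_nhds_x_imp_x[OF assms(2)]]]
      by (simp add: dist_norm)
  qed
qed

text \<open>Two local lifts of the same map differ by a lattice-valued function, which is locally
  constant. This makes tangent maps and flow generators well defined; the domain is general so that
  curves and charts are both covered.\<close>

lemma lift_derivative_unique:
  fixes G H :: "'a::real_normed_vector \<Rightarrow> real ^ 'n::finite"
  assumes "(G has_derivative L) (at x)" "(H has_derivative M) (at x)"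
    and "\<forall>\<^sub>F y in nhds x. torus_proj (G y) = torus_proj (H y)"
  shows "L = M"
proof -
  have D: "((\<lambda>y. G y - H y) has_derivative (\<lambda>h. L h - M h)) (at x)"
    using assms(1,2) by (rule has_derivative_diff)
  have "\<forall>\<^sub>F y in nhds x. G y - H y = G x - H x"
    using assms(3) has_derivative_continuous[OF D]
    by (intro continuous_into_lattice_locally_constant) (simp_all add: torus_proj_eq_iff)
  then have "((\<lambda>y. G y - H y) has_derivative (\<lambda>h. 0)) (at x)"
    by (intro has_derivative_transform_eventually[OF has_derivative_const[of "G x - H x"]])
      (auto simp: eventually_at_filter elim: eventually_mono)
  from has_derivative_unique[OF D this] show ?thesis
    by (simp add: fun_eq_iff)
qed

text \<open>The lift in \<open>has_torus_velocity\<close> may change with the time and is only known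
  to be differentiable at one instant, so each coordinate is tested by a cosine, which does not see
  lattice translations.\<close>

lemma constant_velocity_path:
  assumes vel: "\<And>t. has_torus_velocity c v t" and c0: "c 0 = torus_proj x"
  shows "c t = torus_proj (x + t *\<^sub>R v)"
proof -
  have "\<forall>s. \<exists>w. c s = torus_proj w" using torus_proj_cases by metis
  then obtain r where r: "\<And>s. c s = torus_proj (r s)" by metis
  have cos_eq: "cos (2 * pi * (y $ i + d)) = cos (2 * pi * (z $ i + d))"
    if yz: "torus_proj y = torus_proj z" for y z :: "real ^ 'a" and i d
  proof -
    obtain k :: int where "y $ i - z $ i = of_int k"
      using yz by (auto simp: torus_proj_eq_iff integer_lattice_def elim!: Ints_cases)
    then have "y $ i = z $ i + of_int k" by simp
    then have "2 * pi * (y $ i + d) = 2 * pi * (z $ i + d) + 2 * pi * of_int k"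
      by (simp add: algebra_simps)
    then show ?thesis by (simp add: cos_add cos_int_2pin sin_int_2pin)
  qed
  have "r t $ i - (x + t *\<^sub>R v) $ i \<in> \<int>" for i
  proof -
    \<comment> \<open>The phase compares the path with the expected line. Its velocity is
      \<open>v $ i - v $ i\<close>, so \<open>u\<close> is constant even though \<open>r\<close> is
      an arbitrary choice of representatives.\<close>
    define u where "u s = cos (2 * pi * (r s $ i + (- s * v $ i - x $ i)))" for s
    have "(u has_real_derivative 0) (at s)" for s
    proof -
      from vel[of s] obtain \<gamma> where \<gamma>: "\<forall>\<^sub>F w in nhds s. c w = torus_proj (\<gamma> w)"
        "(\<gamma> has_vector_derivative v) (at s)"
        unfolding has_torus_velocity_def by blast
      have "((\<lambda>w. \<gamma> w $ i) has_vector_derivative v $ i) (at s)"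
        using bounded_linear.has_vector_derivative[OF bounded_linear_vec_nth \<gamma>(2)] .
      then have [derivative_intros]: "((\<lambda>w. \<gamma> w $ i) has_real_derivative v $ i) (at s)"
        by (simp add: has_real_derivative_iff_has_vector_derivative)
      have D: "((\<lambda>w. cos (2 * pi * (\<gamma> w $ i + (- w * v $ i - x $ i)))) has_real_derivative 0) (at s)"
        by (auto intro!: derivative_eq_intros)
      have E: "\<forall>\<^sub>F w in nhds s. u w = cos (2 * pi * (\<gamma> w $ i + (- w * v $ i - x $ i)))"
        using \<gamma>(1)
      proof eventually_elim
        case (elim w)
        then show ?case unfolding u_def using r cos_eq by metis
      qed
      show ?thesis using D DERIV_cong_ev[OF refl E refl] by (simp only:)
    qed
    then have "u t = u 0" by (intro DERIV_isconst_all) blast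
    also have "u 0 = 1"
      unfolding u_def using cos_eq[of "r 0" x i "- x $ i"] c0 r by simp
    \<comment> \<open>The cosine takes the value 1 only at multiples of 2 pi, so the deviation from
      the line is an integer.\<close>
    finally obtain k :: int where
      "2 * pi * (r t $ i + (- t * v $ i - x $ i)) = real_of_int k * 2 * pi"
      unfolding u_def cos_one_2pi_int by blast
    then have "r t $ i + (- t * v $ i - x $ i) = real_of_int k" by simp
    then show ?thesis by (simp add: algebra_simps)
  qed
  then show ?thesis by (simp add: r torus_proj_eq_iff integer_lattice_def)
qed

section \<open>Density of the orbits\<close>

text \<open>Transfers the simultaneous Kronecker theorem with a real parameter: the coordinates are
  renumbered by \<open>f\<close>, and the integers it supplies become, up to sign, the lattice
  vector \<open>m\<close>.\<close>

lemma Kronecker_dense: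
  fixes a x :: "real ^ 'n::finite"
  assumes "rationally_independent a" "\<epsilon> > 0"
  obtains t m where "m \<in> integer_lattice" "norm (t *\<^sub>R a + m - x) < \<epsilon>"
proof -
  obtain f where f: "bij_betw f {..<CARD('n)} (UNIV :: 'n set)"
    using ex_bij_betw_nat_finite[of "UNIV :: 'n set"] by (auto simp: atLeast0LessThan)
  \<comment> \<open>\<open>Z.independent\<close> is a property of a set, so repeated entries of
    \<open>a\<close> must be excluded; \<open>a $ i = a $ j\<close> would be a relation with
    coefficients 1 and -1.\<close>
  have inj_a: "inj (($) a)"
  proof (rule injI, rule ccontr)
    fix i j assume ij: "a $ i = a $ j" "i \<noteq> j"
    let ?m = "\<lambda>k. if k = i then 1 else if k = j then - 1 else 0 :: int"
    have "(\<Sum>k\<in>UNIV. real_of_int (?m k) * a $ k)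
        = (\<Sum>k\<in>UNIV. (if k = i then a $ k else 0) - (if k = j then a $ k else 0))"
      using ij by (intro sum.cong) auto
    also have "\<dots> = 0" using ij by (simp add: sum_subtractf)
    finally have "?m i = 0"
      by (rule assms(1)[unfolded rationally_independent_def, rule_format, of ?m])
    then show False by simp
  qed
  interpret Z: Modules.module "\<lambda>r. (*) (real_of_int r)"
    by (simp add: Modules.module.intro distrib_left mult.commute)
  let ?\<theta> = "\<lambda>k. a $ f k"
  have "Z.independent (?\<theta> ` {..<CARD('n)})"
    unfolding Z.independent_explicit_module
  proof (intro allI impI)
    fix T u v
    assume T: "finite T" "T \<subseteq> ?\<theta> ` {..<CARD('n)}" "(\<Sum>v\<in>T. real_of_int (u v) * v) = 0" "v \<in> T"
    define m where "m j = (if a $ j \<in> T then u (a $ j) else 0)" for j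
    have "(\<Sum>j\<in>UNIV. real_of_int (m j) * a $ j) = (\<Sum>j\<in>($) a -` T. real_of_int (u (a $ j)) * a $ j)"
      by (intro sum.mono_neutral_cong_right) (auto simp: m_def)
    also have "\<dots> = (\<Sum>v\<in>($) a ` (($) a -` T). real_of_int (u v) * v)"
      using inj_a by (subst sum.reindex) (auto simp: inj_on_def)
    also have "($) a ` (($) a -` T) = T" using T(2) by auto
    finally have "m j = 0" for j using assms(1) T(3) unfolding rationally_independent_def by auto
    moreover obtain j where "v = a $ j" using T by auto
    ultimately show "u v = 0" using T(4) unfolding m_def by metis
  qed
  moreover have "inj_on ?\<theta> {..<CARD('n)}"
    using inj_a bij_betw_imp_inj_on[OF f] by (auto simp: inj_on_def)
  \<comment> \<open>Coordinate errors below \<epsilon>/n sum to less than \<epsilon> in the 1-norm,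
    which bounds the Euclidean norm.\<close>
  moreover have "\<epsilon> / CARD('n) > 0" using assms(2) by simp
  ultimately obtain t h where
    th: "\<And>i. i < CARD('n) \<Longrightarrow> \<bar>t * ?\<theta> i - of_int (h i) - x $ f i\<bar> < \<epsilon> / CARD('n)"
    using Kronecker_thm_1[where \<alpha> = "\<lambda>i. x $ f i"] by blast
  define m :: "real ^ 'n" where "m = (\<chi> j. - of_int (h (inv_into {..<CARD('n)} f j)))"
  have comp: "\<bar>(t *\<^sub>R a + m - x) $ j\<bar> < \<epsilon> / CARD('n)" for j
  proof -
    let ?k = "inv_into {..<CARD('n)} f j"
    have "j \<in> f ` {..<CARD('n)}" using f by (simp add: bij_betw_def)
    then have "f ?k = j" "?k < CARD('n)"
      using inv_into_into[of j f "{..<CARD('n)}"] by (auto simp: f_inv_into_f)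
    with th[of ?k] show ?thesis by (simp add: m_def)
  qed
  have "norm (t *\<^sub>R a + m - x) \<le> (\<Sum>j\<in>UNIV. \<bar>(t *\<^sub>R a + m - x) $ j\<bar>)"
    by (rule norm_le_l1_cart)
  also have "\<dots> < (\<Sum>j\<in>(UNIV :: 'n set). \<epsilon> / CARD('n))"
    by (intro sum_strict_mono comp) auto
  also have "\<dots> = \<epsilon>" by simp
  finally show ?thesis
    by (intro that[of m t]) (auto simp: m_def integer_lattice_def)
qed

section \<open>From orbit equivariance to linearity modulo the lattice\<close>

text \<open>Here \<open>r\<close> is an arbitrary, possibly discontinuous, choice of representatives of a torus map.
  Modulo the lattice, \<open>x \<mapsto> r (x + z) - r x\<close> is constant on the orbit of \<open>0\<close>, hence everywhere.\<close>

lemma orbit_equivariant_additive: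
  fixes a :: "real ^ 'n::finite" and r :: "real ^ 'n \<Rightarrow> real ^ 'n"
  assumes indep: "rationally_independent a"
    and periodic: "\<And>x y. x - y \<in> integer_lattice \<Longrightarrow> r x - r y \<in> integer_lattice"
    and equivariant: "\<And>t. \<exists>s. \<forall>y. r (y + t *\<^sub>R a) - r y - s *\<^sub>R a \<in> integer_lattice"
    and local: "\<And>x. \<exists>U G. open U \<and> x \<in> U \<and> (\<forall>y\<in>U. r y - G y \<in> integer_lattice) \<and>
                  continuous (at x) G"
  shows "r (x + z) - r x - (r z - r 0) \<in> integer_lattice"
proof -
  \<comment> \<open>One \<open>s\<close> serves all base points, so it cancels between
    \<open>z\<close> and 0. Lattice translates of the orbit are included because
    \<open>Kronecker_dense\<close> produces these.\<close>
  have orbit: "r (w + z) - r w - (r z - r 0) \<in> integer_lattice"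
    if "w = t *\<^sub>R a + m" "m \<in> integer_lattice" for w t m
  proof -
    obtain s where s: "\<And>y. r (y + t *\<^sub>R a) - r y - s *\<^sub>R a \<in> integer_lattice"
      using equivariant by blast
    have 1: "r (w + z) - r (z + t *\<^sub>R a) \<in> integer_lattice" "r w - r (0 + t *\<^sub>R a) \<in> integer_lattice"
      using that by (auto intro!: periodic)
    have "r (w + z) - r w - (r z - r 0) = (r (w + z) - r (z + t *\<^sub>R a)) - (r w - r (0 + t *\<^sub>R a))
       + ((r (z + t *\<^sub>R a) - r z - s *\<^sub>R a) - (r (0 + t *\<^sub>R a) - r 0 - s *\<^sub>R a))"
      by (simp add: algebra_simps)
    then show ?thesis using 1 s by (metis lattice_add lattice_diff)
  qed
  obtain U G where U: "open U" "x + z \<in> U" "\<And>y. y \<in> U \<Longrightarrow> r y - G y \<in> integer_lattice"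
    "continuous (at (x + z)) G" using local[of "x + z"] by blast
  obtain V H where V: "open V" "x \<in> V" "\<And>y. y \<in> V \<Longrightarrow> r y - H y \<in> integer_lattice"
    "continuous (at x) H" using local[of x] by blast
  have "\<forall>k. \<exists>w. norm (w - x) < 1 / real (Suc k) \<and> (\<exists>t m. w = t *\<^sub>R a + m \<and> m \<in> integer_lattice)"
  proof
    fix k
    show "\<exists>w. norm (w - x) < 1 / real (Suc k) \<and> (\<exists>t m. w = t *\<^sub>R a + m \<and> m \<in> integer_lattice)"
      using Kronecker_dense[OF indep, of "1 / real (Suc k)" x] by (metis of_nat_0_less_iff zero_less_Suc zero_less_divide_1_iff)
  qed
  then obtain w where w: "\<And>k. norm (w k - x) < 1 / real (Suc k)"
    and w_orbit: "\<And>k. r (w k + z) - r (w k) - (r z - r 0) \<in> integer_lattice"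
    using orbit by metis
  have "(\<lambda>k. w k - x) \<longlonglongrightarrow> 0"
    using w by (intro LIMSEQ_norm_0) auto
  then have wx: "w \<longlonglongrightarrow> x" by (simp add: LIM_zero_iff)
  then have wz: "(\<lambda>k. w k + z) \<longlonglongrightarrow> x + z" by (intro tendsto_intros)
  \<comment> \<open>The limit is taken in the representatives \<open>G\<close> and \<open>H\<close>,
    which are continuous at the limit points; the lattice is closed, so membership survives the
    limit and passes back to \<open>r\<close>.\<close>
  have GH: "(\<lambda>k. G (w k + z) - H (w k) - (r z - r 0)) \<longlonglongrightarrow> G (x + z) - H x - (r z - r 0)"
    using isCont_tendsto_compose[OF U(4) wz] isCont_tendsto_compose[OF V(4) wx]
    by (intro tendsto_intros)
  have "\<forall>\<^sub>F k in sequentially. w k + z \<in> U" "\<forall>\<^sub>F k in sequentially. w k \<in> V"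
    using topological_tendstoD[OF wz U(1,2)] topological_tendstoD[OF wx V(1,2)] .
  then have "\<forall>\<^sub>F k in sequentially. G (w k + z) - H (w k) - (r z - r 0) \<in> integer_lattice"
  proof eventually_elim
    case (elim k)
    have "G (w k + z) - H (w k) - (r z - r 0)
        = (r (w k + z) - r (w k) - (r z - r 0)) - (r (w k + z) - G (w k + z)) + (r (w k) - H (w k))"
      by (simp add: algebra_simps)
    then show ?case using U(3)[OF elim(1)] V(3)[OF elim(2)] w_orbit[of k] by (metis lattice_add lattice_diff)
  qed
  then have lim: "G (x + z) - H x - (r z - r 0) \<in> integer_lattice"
    using lattice_limit[OF GH] by simp
  have "r (x + z) - r x - (r z - r 0)
      = (G (x + z) - H x - (r z - r 0)) + (r (x + z) - G (x + z)) - (r x - H x)"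
    by (simp add: algebra_simps)
  then show ?thesis using lim U(2,3) V(2,3) by (metis lattice_add lattice_diff)
qed

text \<open>By additivity, \<open>r x - r 0\<close> is congruent to k times \<open>r y - r 0\<close>
  for y = x/k and every positive integer k. With \<open>G\<close> in place of \<open>r\<close> these
  multiples tend to \<open>L x\<close>, and the lattice is closed.\<close>

lemma additive_mod_lattice_linear:
  fixes r :: "real ^ 'n::finite \<Rightarrow> real ^ 'm::finite"
  assumes additive: "\<And>x z. r (x + z) - r x - (r z - r 0) \<in> integer_lattice"
    and U: "open U" "0 \<in> U" "\<And>y. y \<in> U \<Longrightarrow> r y - G y \<in> integer_lattice"
    and G: "(G has_derivative L) (at 0)"
  shows "r x - (L x + r 0) \<in> integer_lattice"
proof -
  have mult: "r (real k *\<^sub>R y) - r 0 - real k *\<^sub>R (r y - r 0) \<in> integer_lattice" for k y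
  proof (induction k)
    case (Suc k)
    from lattice_add[OF Suc additive[of "real k *\<^sub>R y" y]] show ?case
      by (simp add: algebra_simps)
  qed simp
  let ?h = "\<lambda>k. 1 / real (Suc k)"
  \<comment> \<open>The difference quotient is taken in the scalar step, not in the vector
    \<open>h *\<^sub>R x\<close>, so that x = 0 is no exception.\<close>
  have "((\<lambda>h. G (h *\<^sub>R x)) has_derivative (\<lambda>h. L (h *\<^sub>R x))) (at 0)"
    using G by (intro has_derivative_compose[where g = G and f = "\<lambda>h. h *\<^sub>R x"])
      (auto intro!: derivative_eq_intros)
  then have "((\<lambda>h. G (h *\<^sub>R x)) has_vector_derivative L x) (at 0)"
    using linear_cmul[OF has_derivative_linear[OF G]] by (simp add: has_vector_derivative_def)
  then have "((\<lambda>h. norm (G (h *\<^sub>R x) - G 0 - h *\<^sub>R L x) / norm h) \<longlongrightarrow> 0) (at 0)"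
    by (simp add: has_vector_derivative_def has_derivative_at)
  moreover have h0: "?h \<longlonglongrightarrow> 0" using LIMSEQ_inverse_real_of_nat by (simp add: inverse_eq_divide)
  then have "filterlim ?h (at 0) sequentially"
    by (auto simp: filterlim_at)
  ultimately have "(\<lambda>k. norm (G (?h k *\<^sub>R x) - G 0 - ?h k *\<^sub>R L x) / norm (?h k)) \<longlonglongrightarrow> 0"
    by (rule filterlim_compose)
  moreover have "norm (G (?h k *\<^sub>R x) - G 0 - ?h k *\<^sub>R L x) / norm (?h k)
      = norm (real (Suc k) *\<^sub>R (G (?h k *\<^sub>R x) - G 0) - L x)" for k
  proof -
    have "real (Suc k) *\<^sub>R (G (?h k *\<^sub>R x) - G 0) - L x
        = real (Suc k) *\<^sub>R (G (?h k *\<^sub>R x) - G 0 - ?h k *\<^sub>R L x)"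
      by (simp add: scaleR_diff_right del: of_nat_Suc)
    then show ?thesis by (simp add: mult.commute del: of_nat_Suc)
  qed
  ultimately have "(\<lambda>k. real (Suc k) *\<^sub>R (G (?h k *\<^sub>R x) - G 0)) \<longlonglongrightarrow> L x"
    by (simp only: tendsto_norm_zero_iff LIM_zero_iff)
  then have lim: "(\<lambda>k. r x - r 0 - real (Suc k) *\<^sub>R (G (?h k *\<^sub>R x) - G 0)) \<longlonglongrightarrow> r x - r 0 - L x"
    by (intro tendsto_intros)
  have "(\<lambda>k. ?h k *\<^sub>R x) \<longlonglongrightarrow> 0" using tendsto_scaleR[OF h0 tendsto_const[of x]] by simp
  then have "\<forall>\<^sub>F k in sequentially. ?h k *\<^sub>R x \<in> U"
    using U(1,2) by (rule topological_tendstoD)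
  then have "\<forall>\<^sub>F k in sequentially.
      r x - r 0 - real (Suc k) *\<^sub>R (G (?h k *\<^sub>R x) - G 0) \<in> integer_lattice"
  proof eventually_elim
    case (elim k)
    let ?y = "?h k *\<^sub>R x"
    have nat_mult: "real (Suc k) *\<^sub>R v \<in> integer_lattice" if "v \<in> integer_lattice" for v :: "real ^ 'm"
      using that Ints_mult[OF Ints_of_nat[of "Suc k"]] by (simp add: integer_lattice_def del: of_nat_Suc)
    have "real (Suc k) *\<^sub>R ?y = x" by (simp del: of_nat_Suc)
    with mult[of "Suc k" ?y] have "r x - r 0 - real (Suc k) *\<^sub>R (r ?y - r 0) \<in> integer_lattice" by simp
    \<comment> \<open>Passing from \<open>r\<close> to \<open>G\<close> costs \<open>Suc k\<close>
      times a lattice vector, which is again a lattice vector.\<close>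
    moreover have "real (Suc k) *\<^sub>R ((r ?y - G ?y) - (r 0 - G 0)) \<in> integer_lattice"
      using lattice_diff[OF U(3)[OF elim] U(3)[OF U(2)]] by (rule nat_mult)
    moreover have "r x - r 0 - real (Suc k) *\<^sub>R (G ?y - G 0)
        = (r x - r 0 - real (Suc k) *\<^sub>R (r ?y - r 0)) + real (Suc k) *\<^sub>R ((r ?y - G ?y) - (r 0 - G 0))"
      by (simp add: algebra_simps)
    ultimately show ?case by (metis lattice_add)
  qed
  with lattice_limit[OF lim] show ?thesis by (simp add: algebra_simps)
qed

section \<open>Affine maps of the torus\<close>

abbreviation real_matrix :: "int ^ 'n ^ 'm \<Rightarrow> real ^ 'n ^ 'm" where
  "real_matrix \<equiv> map_matrix real_of_int"

lemma real_matrix_mult: "real_matrix (A ** B) = real_matrix A ** real_matrix B"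
  by (simp add: vec_eq_iff matrix_matrix_mult_def)

lemma real_matrix_one: "real_matrix (mat 1) = mat 1"
  by (simp add: vec_eq_iff mat_def)

lemma real_matrix_eq_iff: "real_matrix A = real_matrix B \<longleftrightarrow> A = B"
  by (simp add: vec_eq_iff)

lemma invertible_mat_one: "invertible (mat 1 :: 'a::semiring_1 ^ 'n::finite ^ 'n)"
  unfolding invertible_def by (metis matrix_mul_lid)

lemma real_matrix_lattice: "x \<in> integer_lattice \<Longrightarrow> real_matrix B *v x \<in> integer_lattice"
  by (auto simp: integer_lattice_def matrix_vector_mult_def intro!: Ints_sum Ints_mult)

lemma real_matrix_diff_lattice:
  "x - y \<in> integer_lattice \<Longrightarrow> real_matrix B *v x - real_matrix B *v y \<in> integer_lattice"
  using real_matrix_lattice[of "x - y" B] by (simp add: matrix_vector_mult_diff_distrib)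

text \<open>The columns of the matrix are the images of the unit vectors, hence integral; the floor
  merely changes the type of the entries.\<close>

lemma linear_preserving_lattice:
  fixes L :: "real ^ 'n::finite \<Rightarrow> real ^ 'm::finite"
  assumes "linear L" "\<And>x. x \<in> integer_lattice \<Longrightarrow> L x \<in> integer_lattice"
  obtains B where "L = (*v) (real_matrix B)"
proof
  let ?B = "\<chi> i j. \<lfloor>matrix L $ i $ j\<rfloor>"
  have "matrix L $ i $ j \<in> \<int>" for i j
    using assms(2)[of "axis j 1"] by (auto simp: integer_lattice_def matrix_def axis_def)
  then have "real_matrix ?B = matrix L"
    by (simp add: vec_eq_iff)
  then show "L = (*v) (real_matrix ?B)"
    using matrix_works[of L] assms(1) by (simp add: fun_eq_iff matrix_vector_mul(1))
qed

lift_definition affine_torus :: "int ^ 'n ^ 'n \<Rightarrow> real ^ 'n \<Rightarrow> 'n::finite torus \<Rightarrow> 'n torus"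
  is "\<lambda>B c x. real_matrix B *v x + c"
  using real_matrix_diff_lattice unfolding integer_lattice_def mem_Collect_eq
    vector_add_component vector_minus_component add_diff_cancel_right by blast

lemma affine_torus_proj [simp]:
  "affine_torus B c (torus_proj x) = torus_proj (real_matrix B *v x + c)"
  by transfer simp

lemma torus_map_eqI: "(\<And>x. R (torus_proj x) = S (torus_proj x)) \<Longrightarrow> R = S"
  by (metis ext torus_proj_cases)

lemma affine_torus_comp:
  "affine_torus A b \<circ> affine_torus B c = affine_torus (A ** B) (real_matrix A *v c + b)"
  by (rule torus_map_eqI)
    (simp add: real_matrix_mult matrix_vector_right_distrib add.assoc flip: matrix_vector_mul_assoc)

lemma affine_torus_id: "affine_torus (mat 1) 0 = id"
  by (rule torus_map_eqI) (simp add: real_matrix_one)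

lemma inv_affine_torus:
  assumes "A ** B = mat 1" "B ** A = mat 1"
  shows "bij (affine_torus B c)"
    and "inv_into UNIV (affine_torus B c) = affine_torus A (- (real_matrix A *v c))"
proof -
  have 1: "affine_torus A (- (real_matrix A *v c)) \<circ> affine_torus B c = id"
    using assms by (simp add: affine_torus_comp affine_torus_id)
  have 2: "affine_torus B c \<circ> affine_torus A (- (real_matrix A *v c)) = id"
    using assms
    by (simp add: affine_torus_comp affine_torus_id real_matrix_one matrix_vector_mul_assoc
        vec.neg flip: real_matrix_mult)
  show "bij (affine_torus B c)" using o_bij[OF 1 2] .
  show "inv_into UNIV (affine_torus B c) = affine_torus A (- (real_matrix A *v c))"
    using inv_unique_comp[OF 2 1] .
qed

section \<open>Smoothness, tangent maps and lifts of affine torus maps\<close>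

lemma has_derivative_affine: "((\<lambda>x. M *v x + c) has_derivative (*v) M) (at x)"
  for M :: "real ^ 'n::finite ^ 'm::finite"
  by (auto intro!: derivative_eq_intros bounded_linear.has_derivative[OF matrix_vector_mul_bounded_linear])

lemma local_rep_affine: "local_rep (affine_torus B c) UNIV (\<lambda>x. real_matrix B *v x + c)"
  by (simp add: local_rep_def)

lemma Ck_on_const: "Ck_on k (\<lambda>x. c) U"
  by (induction k arbitrary: c) simp_all

text \<open>Each first directional derivative is constant, so the higher orders fall under
  \<open>Ck_on_const\<close>.\<close>

lemma Ck_on_affine: "Ck_on k (\<lambda>x. M *v x + c) U"
  for M :: "real ^ 'n::finite ^ 'm::finite"
proof (cases k)
  case 0
  then show ?thesis
    using has_derivative_continuous[OF has_derivative_affine[of M c]]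
    by (simp add: continuous_at_imp_continuous_on)
next
  case (Suc k)
  have "frechet_derivative (\<lambda>x. M *v x + c) (at x) = (*v) M" for x
    using frechet_derivative_at[OF has_derivative_affine] by metis
  then show ?thesis
    using has_derivative_affine[of M c] by (auto simp: Suc Ck_on_const differentiable_def)
qed

lemma smooth_affine_torus: "smooth_torus_map (affine_torus B c)"
  unfolding smooth_torus_map_def using local_rep_affine Ck_on_affine by blast

lemma affine_torus_Diff:
  assumes "invertible B"
  shows "affine_torus B c \<in> carrier Diff_torus"
proof -
  obtain A where "A ** B = mat 1" "B ** A = mat 1"
    using assms unfolding invertible_def by blast
  note inv = inv_affine_torus[OF this, of c]
  then show ?thesis by (simp add: Diff_torus_def smooth_affine_torus)
qed

lemma local_rep_derivative_unique:
  assumes "local_rep R U G" "x \<in> U" "(G has_derivative L) (at x)"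
    and "local_rep R V H" "x \<in> V" "(H has_derivative M) (at x)"
  shows "L = M"
proof (rule lift_derivative_unique[OF assms(3,6)])
  have "\<forall>\<^sub>F y in nhds x. y \<in> U" "\<forall>\<^sub>F y in nhds x. y \<in> V"
    using assms by (auto simp: local_rep_def intro: eventually_nhds_in_open)
  then show "\<forall>\<^sub>F y in nhds x. torus_proj (G y) = torus_proj (H y)"
    by eventually_elim (use assms(1,4) in \<open>metis local_rep_def\<close>)
qed

text \<open>The affine formula represents the map on the whole space with the same derivative
  everywhere, so a competing representative at any preimage of \<open>p\<close> can be compared with
  it at its own base point.\<close>

lemma torus_tangent_affine: "torus_tangent (affine_torus B c) p = (*v) (real_matrix B)"
proof -
  obtain x where x: "torus_proj x = p" using torus_proj_cases by metis
  show ?thesis unfolding torus_tangent_def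
  proof (rule the_equality)
    show "\<exists>x U G. torus_proj x = p \<and> x \<in> U \<and> local_rep (affine_torus B c) U G \<and>
            (G has_derivative (*v) (real_matrix B)) (at x)"
      using x local_rep_affine has_derivative_affine by blast
  next
    fix L assume "\<exists>x U G. torus_proj x = p \<and> x \<in> U \<and> local_rep (affine_torus B c) U G \<and>
            (G has_derivative L) (at x)"
    then show "L = (*v) (real_matrix B)"
      using local_rep_derivative_unique local_rep_affine has_derivative_affine by blast
  qed
qed

lemma matrix_vector_mult_inject: "(*v) A = (*v) B \<longleftrightarrow> A = B"
  for A B :: "real ^ 'n::finite ^ 'm::finite"
  by (metis matrix_of_matrix_vector_mul)

text \<open>A lift is a local representative on the whole space, so uniqueness of derivatives fixes
  the linear part. This later makes \<open>nu_flow\<close> well defined and identifies inverse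
  matrices.\<close>

lemma lift_derivative_is_affine_iff: "lift_derivative_is (affine_torus B c) A \<longleftrightarrow> A = B"
proof
  assume "lift_derivative_is (affine_torus B c) A"
  then obtain Rh where Rh: "is_lift (affine_torus B c) Rh"
    "\<And>x. (Rh has_derivative (*v) (real_matrix A)) (at x)"
    unfolding lift_derivative_is_def by blast
  have "local_rep (affine_torus B c) UNIV Rh"
    using Rh(1) by (simp add: is_lift_def local_rep_def fun_eq_iff)
  then have "(*v) (real_matrix A) = (*v) (real_matrix B)"
    using local_rep_derivative_unique[OF _ UNIV_I Rh(2) local_rep_affine UNIV_I has_derivative_affine]
    by blast
  then show "A = B" by (simp add: matrix_vector_mult_inject real_matrix_eq_iff)
next
  have "is_lift (affine_torus B c) (\<lambda>x. real_matrix B *v x + c)"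
    using has_derivative_continuous[OF has_derivative_affine[of "real_matrix B" c]]
    by (auto simp: is_lift_def continuous_at_imp_continuous_on)
  then show "A = B \<Longrightarrow> lift_derivative_is (affine_torus B c) A"
    unfolding lift_derivative_is_def using has_derivative_affine by blast
qed

section \<open>Inverses and normalizers in the diffeomorphism group\<close>

lemma inv_Diff_torus:
  assumes "R \<in> carrier Diff_torus"
  shows "inv\<^bsub>Diff_torus\<^esub> R = inv_into UNIV R"
  unfolding m_inv_def
proof (rule the_equality)
  have "bij R" using assms by (simp add: Diff_torus_def)
  then have "R \<circ> inv_into UNIV R = id" "inv_into UNIV R \<circ> R = id"
    by (simp_all add: bij_is_surj bij_is_inj flip: surj_iff inj_iff)
  then show "inv_into UNIV R \<in> carrier Diff_torus \<and> R \<otimes>\<^bsub>Diff_torus\<^esub> inv_into UNIV R = \<one>\<^bsub>Diff_torus\<^esub>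
      \<and> inv_into UNIV R \<otimes>\<^bsub>Diff_torus\<^esub> R = \<one>\<^bsub>Diff_torus\<^esub>"
    using assms \<open>bij R\<close> by (auto simp: Diff_torus_def bij_imp_bij_inv inv_inv_eq)
  fix S assume "S \<in> carrier Diff_torus \<and> R \<otimes>\<^bsub>Diff_torus\<^esub> S = \<one>\<^bsub>Diff_torus\<^esub>
      \<and> S \<otimes>\<^bsub>Diff_torus\<^esub> R = \<one>\<^bsub>Diff_torus\<^esub>"
  then show "S = inv_into UNIV R"
    by (intro inv_unique_comp[symmetric]) (auto simp: Diff_torus_def)
qed

text \<open>\<open>normalizer\<close> is the stabilizer of \<open>F\<close> under conjugation acting
  on subsets of the carrier, whence the hypothesis on \<open>F\<close>.\<close>

lemma normalizer_Diff_torus_iff: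
  assumes "F \<subseteq> carrier Diff_torus"
  shows "R \<in> normalizer Diff_torus F \<longleftrightarrow>
    R \<in> carrier Diff_torus \<and> (\<lambda>f. R \<circ> f \<circ> inv_into UNIV R) ` F = F"
proof (cases "R \<in> carrier Diff_torus")
  case True
  then show ?thesis
    using assms inv_Diff_torus[OF True]
    by (auto simp: normalizer_def stabilizer_def l_coset_def r_coset_def Diff_torus_def image_iff o_assoc)
next
  case False
  then show ?thesis by (simp add: normalizer_def stabilizer_def)
qed

section \<open>The normalizer of the flow\<close>

text \<open>Additivity modulo the lattice reduces \<open>R\<close> to its derivative at 0. Here
  \<open>s\<close> may depend on \<open>t\<close> in any way, and \<open>R\<close> is any smooth
  map, so that a diffeomorphism and its inverse can be treated separately.\<close>

lemma orbit_equivariant_affine: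
  fixes a :: "real ^ 'n::finite"
  assumes indep: "rationally_independent a" and smooth: "smooth_torus_map R"
    and equivariant: "\<And>t. \<exists>s. R \<circ> affine_torus (mat 1) (t *\<^sub>R a) = affine_torus (mat 1) (s *\<^sub>R a) \<circ> R"
  obtains B c where "R = affine_torus B c"
proof -
  have "\<forall>x. \<exists>y. R (torus_proj x) = torus_proj y" using torus_proj_cases by metis
  then obtain r where r: "\<And>x. R (torus_proj x) = torus_proj (r x)" by metis
  have periodic: "r x - r y \<in> integer_lattice" if "x - y \<in> integer_lattice" for x y
    using that r by (metis torus_proj_eq_iff)
  have eqv: "\<exists>s. \<forall>y. r (y + t *\<^sub>R a) - r y - s *\<^sub>R a \<in> integer_lattice" for t
  proof -
    obtain s where s: "R \<circ> affine_torus (mat 1) (t *\<^sub>R a) = affine_torus (mat 1) (s *\<^sub>R a) \<circ> R"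
      using equivariant by blast
    have "r (y + t *\<^sub>R a) - r y - s *\<^sub>R a \<in> integer_lattice" for y
      using fun_cong[OF s, of "torus_proj y"]
      by (simp add: r real_matrix_one torus_proj_eq_iff diff_diff_eq)
    then show ?thesis by blast
  qed
  have diff: "\<exists>U G. open U \<and> x \<in> U \<and> (\<forall>y\<in>U. r y - G y \<in> integer_lattice) \<and> G differentiable (at x)" for x
  proof -
    obtain U G where UG: "x \<in> U" "local_rep R U G" "\<forall>k. Ck_on k G U"
      using smooth unfolding smooth_torus_map_def by blast
    have "Ck_on (Suc 0) G U" using UG(3) by blast
    then have "G differentiable (at x)" using UG(1) by simp
    moreover have "open U" "\<forall>y\<in>U. r y - G y \<in> integer_lattice"
      using UG(2) by (auto simp: local_rep_def r torus_proj_eq_iff)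
    ultimately show ?thesis using UG(1) by blast
  qed
  then have cont: "\<exists>U G. open U \<and> x \<in> U \<and> (\<forall>y\<in>U. r y - G y \<in> integer_lattice) \<and> continuous (at x) G" for x
    by (meson differentiable_imp_continuous_within)
  have additive: "r (x + z) - r x - (r z - r 0) \<in> integer_lattice" for x z
    by (rule orbit_equivariant_additive[OF indep periodic eqv cont])
  obtain U G L where U: "open U" "0 \<in> U" "\<And>y. y \<in> U \<Longrightarrow> r y - G y \<in> integer_lattice"
    and G: "(G has_derivative L) (at 0)"
    using diff[of 0] unfolding differentiable_def by blast
  have affine: "r x - (L x + r 0) \<in> integer_lattice" for x
    by (rule additive_mod_lattice_linear[OF additive U G])
  \<comment> \<open>\<open>r - r 0\<close> sends the lattice to itself by periodicity, and
    \<open>L\<close> differs from it by lattice vectors; hence \<open>L\<close> is integral.\<close>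
  have "L x \<in> integer_lattice" if "x \<in> integer_lattice" for x
  proof -
    have "L x = (r x - r 0) - (r x - (L x + r 0))" by simp
    moreover have "r x - r 0 \<in> integer_lattice" using that by (intro periodic) simp
    ultimately show ?thesis using affine lattice_diff by metis
  qed
  then obtain B where "L = (*v) (real_matrix B)"
    using linear_preserving_lattice has_derivative_linear[OF G] by metis
  then have "R = affine_torus B (r 0)"
    using affine by (intro torus_map_eqI) (simp add: r torus_proj_eq_iff)
  then show ?thesis by (rule that)
qed

text \<open>A line in direction \<open>v\<close> covered modulo the lattice by the line in direction \<open>a\<close>: the
  functional \<open>x \<mapsto> a\<^sub>j x\<^sub>i - a\<^sub>i x\<^sub>j\<close> vanishes at \<open>a\<close> and takes countably many values on the lattice.\<close>

lemma line_in_orbit_parallel: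
  fixes a v :: "real ^ 'n::finite"
  assumes "a \<noteq> 0" "\<And>t. \<exists>s. t *\<^sub>R v - s *\<^sub>R a \<in> integer_lattice"
  obtains \<alpha> where "v = \<alpha> *\<^sub>R a"
proof -
  have cross: "a $ j * v $ i - a $ i * v $ j = 0" for i j
  proof (rule ccontr)
    let ?w = "a $ j * v $ i - a $ i * v $ j"
    \<comment> \<open>Applying the functional to \<open>t *\<^sub>R v - s *\<^sub>R a\<close>
      cancels the \<open>s\<close> term and leaves \<open>t * ?w\<close>, so \<open>?f\<close> would
      recover every real \<open>t\<close> from a pair of integers.\<close>
    let ?f = "\<lambda>(p, q). (a $ j * real_of_int p - a $ i * real_of_int q) / ?w"
    assume w: "?w \<noteq> 0"
    have "t \<in> range ?f" for t
    proof -
      obtain s where s: "t *\<^sub>R v - s *\<^sub>R a \<in> integer_lattice" using assms(2) by blast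
      then have "t * v $ i - s * a $ i \<in> \<int>" "t * v $ j - s * a $ j \<in> \<int>"
        by (auto simp: integer_lattice_def)
      then obtain p q where p: "t * v $ i - s * a $ i = of_int p" and q: "t * v $ j - s * a $ j = of_int q"
        by (metis Ints_cases)
      have "a $ j * of_int p - a $ i * of_int q = t * ?w"
        unfolding p[symmetric] q[symmetric] by (simp add: algebra_simps)
      then have "t = ?f (p, q)" using w by (simp add: field_simps)
      then show ?thesis by blast
    qed
    then have "range ?f = UNIV" by blast
    then have "countable (UNIV :: real set)" by (metis countable_image countableI_type)
    then show False using uncountable_UNIV_real by blast
  qed
  obtain i where i: "a $ i \<noteq> 0" using assms(1) by (auto simp: vec_eq_iff)
  have "v $ j = (v $ i / a $ i) * a $ j" for j
    using cross[of i j] i by (simp add: field_simps)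
  then have "v = (v $ i / a $ i) *\<^sub>R a"
    unfolding vec_eq_iff vector_scaleR_component real_scaleR_def by blast
  then show ?thesis by (rule that)
qed

section \<open>The two ambient groups\<close>

lemma group_GL_int: "Group.group (GL_int :: (int ^ 'n::finite ^ 'n) monoid)"
proof (rule groupI)
  fix A :: "int ^ 'n ^ 'n" assume "A \<in> carrier GL_int"
  then obtain B where "A ** B = mat 1" "B ** A = mat 1" by (auto simp: GL_int_def invertible_def)
  then show "\<exists>B\<in>carrier GL_int. B \<otimes>\<^bsub>GL_int\<^esub> A = \<one>\<^bsub>GL_int\<^esub>"
    by (auto simp: GL_int_def invertible_def)
qed (auto simp: GL_int_def matrix_mul_assoc invertible_mult invertible_mat_one)

lemma comm_group_mult_group_real: "comm_group mult_group_real"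
proof (rule comm_groupI)
  fix x assume "x \<in> carrier mult_group_real"
  then show "\<exists>y\<in>carrier mult_group_real. y \<otimes>\<^bsub>mult_group_real\<^esub> x = \<one>\<^bsub>mult_group_real\<^esub>"
    by (intro bexI[of _ "inverse x"]) (auto simp: mult_group_real_def)
qed (auto simp: mult_group_real_def)

section \<open>The flow in a rationally independent direction and its generator\<close>

locale irrational_flow =
  fixes a :: "real ^ 'n::finite" and \<phi> :: "real \<Rightarrow> 'n torus \<Rightarrow> 'n torus"
  assumes indep: "rationally_independent a"
    and generates: "generates_flow (\<lambda>p. a) \<phi>"
begin

text \<open>Integral curves of a constant field are straight lines modulo the lattice, so
  \<open>generates\<close> leaves only the translation flow.\<close>

lemma flow_eq: "\<phi> t = affine_torus (mat 1) (t *\<^sub>R a)"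
proof (rule torus_map_eqI)
  fix x
  have "\<phi> t (torus_proj x) = torus_proj (x + t *\<^sub>R a)"
    using generates by (intro constant_velocity_path) (auto simp: generates_flow_def)
  then show "\<phi> t (torus_proj x) = affine_torus (mat 1) (t *\<^sub>R a) (torus_proj x)"
    by (simp add: real_matrix_one)
qed

lemma flow_generator_eq: "flow_generator \<phi> = (\<lambda>p. a)"
  unfolding flow_generator_def
proof (rule the_equality, rule generates, rule ext)
  fix Y p assume Y: "generates_flow Y \<phi>"
  have vel: "has_torus_velocity (\<lambda>s. \<phi> s p) (Y p) 0" "has_torus_velocity (\<lambda>s. \<phi> s p) a 0"
    using Y generates unfolding generates_flow_def by (metis id_apply)+
  obtain \<gamma> where \<gamma>: "\<forall>\<^sub>F s in nhds 0. \<phi> s p = torus_proj (\<gamma> s)" "(\<gamma> has_vector_derivative Y p) (at 0)"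
    using vel(1) unfolding has_torus_velocity_def by blast
  obtain \<delta> where \<delta>: "\<forall>\<^sub>F s in nhds 0. \<phi> s p = torus_proj (\<delta> s)" "(\<delta> has_vector_derivative a) (at 0)"
    using vel(2) unfolding has_torus_velocity_def by blast
  have "\<forall>\<^sub>F s in nhds 0. torus_proj (\<gamma> s) = torus_proj (\<delta> s)"
    using \<gamma>(1) \<delta>(1) by eventually_elim simp
  then have "(\<lambda>h. h *\<^sub>R Y p) = (\<lambda>h. h *\<^sub>R a)"
    using \<gamma>(2) \<delta>(2) unfolding has_vector_derivative_def by (intro lift_derivative_unique)
  from fun_cong[OF this, of 1] show "Y p = a" by simp
qed

lemma direction_nonzero: "a \<noteq> 0"
proof
  assume "a = 0"
  then have "(1 :: int) = 0"
    using indep[unfolded rationally_independent_def, rule_format, of "\<lambda>_. 1"] by simp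
  then show False by simp
qed

text \<open>Each row of the difference is an integer relation among the entries of \<open>a\<close>,
  hence trivial.\<close>

lemma matrix_eq_if_agree_on_direction:
  assumes "real_matrix A *v a = real_matrix B *v a"
  shows "A = B"
proof -
  have "A $ i $ j - B $ i $ j = 0" for i j
  proof -
    have "(\<Sum>j\<in>UNIV. real_of_int (A $ i $ j - B $ i $ j) * a $ j)
        = (real_matrix A *v a - real_matrix B *v a) $ i"
      by (simp add: matrix_vector_mult_def left_diff_distrib sum_subtractf)
    also have "\<dots> = 0" using assms by simp
    finally show ?thesis
      by (rule indep[unfolded rationally_independent_def, rule_format])
  qed
  then show ?thesis by (simp add: vec_eq_iff)
qed

lemma eigenvalue_nonzero:
  assumes "invertible B" "real_matrix B *v a = \<alpha> *\<^sub>R a"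
  shows "\<alpha> \<noteq> 0"
proof
  assume "\<alpha> = 0"
  obtain A where A: "A ** B = mat 1" using assms(1) unfolding invertible_def by blast
  have "a = real_matrix A *v (real_matrix B *v a)"
    by (simp add: matrix_vector_mul_assoc real_matrix_one A flip: real_matrix_mult)
  also have "\<dots> = 0" using assms(2) \<open>\<alpha> = 0\<close> by simp
  finally show False using direction_nonzero by blast
qed

text \<open>Moving the translation by \<open>t *\<^sub>R a\<close> past the affine map applies the
  matrix to it; the constant \<open>c\<close> commutes with translations.\<close>

lemma affine_torus_flow:
  assumes "real_matrix B *v a = \<alpha> *\<^sub>R a"
  shows "affine_torus B c \<circ> \<phi> t = \<phi> (\<alpha> * t) \<circ> affine_torus B c"
  using assms
  by (simp add: flow_eq affine_torus_comp real_matrix_one matrix_vector_mult_scaleR mult.commute add.commute)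

lemma flow_subset_Diff: "F_flow \<phi> \<subseteq> carrier Diff_torus"
  by (auto simp: F_flow_def flow_eq intro: affine_torus_Diff invertible_mat_one)

text \<open>Forwards, setwise invariance of the flow makes both \<open>R\<close> and its inverse
  affine, so the linear part is invertible over the integers. Backwards, conjugation by
  \<open>R\<close> rescales time by the eigenvalue.\<close>

lemma S_flow_iff:
  "R \<in> S_flow \<phi> \<longleftrightarrow> (\<exists>B c \<alpha>. R = affine_torus B c \<and> invertible B \<and> real_matrix B *v a = \<alpha> *\<^sub>R a)"
proof
  assume "R \<in> S_flow \<phi>"
  then have R: "R \<in> carrier Diff_torus" and conj: "(\<lambda>f. R \<circ> f \<circ> inv_into UNIV R) ` range \<phi> = range \<phi>"
    using normalizer_Diff_torus_iff[OF flow_subset_Diff] by (auto simp: S_flow_def F_flow_def)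
  let ?S = "inv_into UNIV R"
  have smooth: "smooth_torus_map R" "smooth_torus_map ?S" and "bij R"
    using R by (auto simp: Diff_torus_def)
  then have inv: "R \<circ> ?S = id" "?S \<circ> R = id"
    by (simp_all add: bij_is_surj bij_is_inj flip: surj_iff inj_iff)
  have eqv: "\<exists>s. R \<circ> \<phi> t = \<phi> s \<circ> R" for t
  proof -
    have "R \<circ> \<phi> t \<circ> ?S \<in> range \<phi>" using conj by blast
    then obtain s where "R \<circ> \<phi> t \<circ> ?S = \<phi> s" by blast
    then have "R \<circ> \<phi> t \<circ> (?S \<circ> R) = \<phi> s \<circ> R" by (simp add: o_assoc)
    then show ?thesis using inv by auto
  qed
  \<comment> \<open>This uses the other inclusion of the conjugation identity: every flow map is a
    conjugate of a flow map.\<close>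
  have eqv': "\<exists>s. ?S \<circ> \<phi> t = \<phi> s \<circ> ?S" for t
  proof -
    have "\<phi> t \<in> (\<lambda>f. R \<circ> f \<circ> ?S) ` range \<phi>" using conj by blast
    then obtain s where "\<phi> t = R \<circ> \<phi> s \<circ> ?S" by blast
    then have "?S \<circ> \<phi> t = (?S \<circ> R) \<circ> \<phi> s \<circ> ?S" by (simp add: o_assoc)
    then show ?thesis using inv by auto
  qed
  obtain B c where B: "R = affine_torus B c"
    using orbit_equivariant_affine[OF indep smooth(1)] eqv[unfolded flow_eq] by metis
  obtain A b where A: "?S = affine_torus A b"
    using orbit_equivariant_affine[OF indep smooth(2)] eqv'[unfolded flow_eq] by metis
  have mat: "C = mat 1" if "affine_torus C d = id" for C d
    using that lift_derivative_is_affine_iff affine_torus_id by metis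
  have "affine_torus B c \<circ> affine_torus A b = id" "affine_torus A b \<circ> affine_torus B c = id"
    using inv unfolding A unfolding B .
  then have "B ** A = mat 1" "A ** B = mat 1"
    unfolding affine_torus_comp by (auto dest: mat)
  then have "invertible B"
    unfolding invertible_def by blast
  \<comment> \<open>At the origin the constant \<open>c\<close> cancels, and the line in the
    direction \<open>real_matrix B *v a\<close> is seen to lie in the orbit of 0 modulo the
    lattice.\<close>
  moreover have "\<exists>s. t *\<^sub>R (real_matrix B *v a) - s *\<^sub>R a \<in> integer_lattice" for t
  proof -
    obtain s where "R \<circ> \<phi> t = \<phi> s \<circ> R" using eqv by blast
    from fun_cong[OF this, of "torus_proj 0"] show ?thesis
      by (auto simp: B flow_eq real_matrix_one torus_proj_eq_iff matrix_vector_mult_scaleR)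
  qed
  then obtain \<alpha> where "real_matrix B *v a = \<alpha> *\<^sub>R a"
    using line_in_orbit_parallel[OF direction_nonzero] by metis
  ultimately show "\<exists>B c \<alpha>. R = affine_torus B c \<and> invertible B \<and> real_matrix B *v a = \<alpha> *\<^sub>R a"
    using B by blast
next
  assume "\<exists>B c \<alpha>. R = affine_torus B c \<and> invertible B \<and> real_matrix B *v a = \<alpha> *\<^sub>R a"
  then obtain B c \<alpha> where R: "R = affine_torus B c" and B: "invertible B" "real_matrix B *v a = \<alpha> *\<^sub>R a"
    by blast
  have R_Diff: "R \<in> carrier Diff_torus" using R B(1) affine_torus_Diff by simp
  then have "R \<circ> inv_into UNIV R = id"
    by (simp add: Diff_torus_def bij_is_surj flip: surj_iff)
  then have conj: "R \<circ> \<phi> t \<circ> inv_into UNIV R = \<phi> (\<alpha> * t)" for t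
    using affine_torus_flow[OF B(2), of c t] by (simp add: R comp_assoc)
  have "(\<lambda>f. R \<circ> f \<circ> inv_into UNIV R) ` range \<phi> = \<phi> ` range ((*) \<alpha>)"
    by (simp only: image_image conj)
  \<comment> \<open>A nonzero rescaling runs through all times, so the conjugates fill the whole
    flow.\<close>
  also have "range ((*) \<alpha>) = UNIV"
    using eigenvalue_nonzero[OF B] by (intro surjI[of _ "\<lambda>x. x / \<alpha>"]) simp
  finally show "R \<in> S_flow \<phi>"
    unfolding S_flow_def F_flow_def
    using R_Diff normalizer_Diff_torus_iff[OF flow_subset_Diff[unfolded F_flow_def]] by blast
qed

section \<open>\<open>rho_flow\<close> and \<open>nu_flow\<close> as eigenvalues\<close>

lemma rho_flow_affine:
  assumes "invertible B" "real_matrix B *v a = \<alpha> *\<^sub>R a"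
  shows "rho_flow \<phi> (affine_torus B c) = \<alpha>"
  unfolding rho_flow_def
  \<comment> \<open>The push-forward of the constant field is constantly
    \<open>real_matrix B *v a\<close>; since \<open>a\<close> is nonzero, the factor is
    unique.\<close>
  using assms eigenvalue_nonzero[OF assms] direction_nonzero
  by (intro the_equality) (auto simp: flow_generator_eq push_forward_def torus_tangent_affine fun_eq_iff)

text \<open>The translation part can be chosen as 0, so membership is a condition on the matrix
  alone.\<close>

lemma Pi_flow_iff: "B \<in> Pi_flow \<phi> \<longleftrightarrow> invertible B \<and> (\<exists>\<alpha>. real_matrix B *v a = \<alpha> *\<^sub>R a)"
proof
  show "B \<in> Pi_flow \<phi> \<Longrightarrow> invertible B \<and> (\<exists>\<alpha>. real_matrix B *v a = \<alpha> *\<^sub>R a)"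
    by (auto simp: Pi_flow_def S_flow_iff lift_derivative_is_affine_iff)
  assume B: "invertible B \<and> (\<exists>\<alpha>. real_matrix B *v a = \<alpha> *\<^sub>R a)"
  then have "affine_torus B 0 \<in> S_flow \<phi>" by (auto simp: S_flow_iff)
  then show "B \<in> Pi_flow \<phi>"
    using B lift_derivative_is_affine_iff[of B 0 B] by (auto simp: Pi_flow_def GL_int_def)
qed

text \<open>Normalizer elements with linear part \<open>B\<close> differ by translations, which
  leave \<open>rho_flow\<close> unchanged, so the description is unambiguous.\<close>

lemma nu_flow_eq:
  assumes "invertible B" "real_matrix B *v a = \<alpha> *\<^sub>R a"
  shows "nu_flow \<phi> B = \<alpha>"
  unfolding nu_flow_def
proof (rule the_equality)
  show "\<exists>R\<in>S_flow \<phi>. lift_derivative_is R B \<and> \<alpha> = rho_flow \<phi> R"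
    using assms rho_flow_affine[OF assms, of 0]
    by (intro bexI[of _ "affine_torus B 0"]) (auto simp: S_flow_iff lift_derivative_is_affine_iff)
  show "r = \<alpha>" if "\<exists>R\<in>S_flow \<phi>. lift_derivative_is R B \<and> r = rho_flow \<phi> R" for r
    using that assms rho_flow_affine by (auto simp: S_flow_iff lift_derivative_is_affine_iff)
qed

lemma nu_flow_eigenvalue: "B \<in> Pi_flow \<phi> \<Longrightarrow> real_matrix B *v a = nu_flow \<phi> B *\<^sub>R a"
  unfolding Pi_flow_iff using nu_flow_eq by metis

lemma nu_flow_nonzero: "B \<in> Pi_flow \<phi> \<Longrightarrow> nu_flow \<phi> B \<noteq> 0"
  using eigenvalue_nonzero[OF _ nu_flow_eigenvalue] by (simp add: Pi_flow_iff)

lemma rho_image: "rho_flow \<phi> ` S_flow \<phi> = nu_flow \<phi> ` Pi_flow \<phi>"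
proof (intro equalityI subsetI)
  fix \<alpha> assume "\<alpha> \<in> rho_flow \<phi> ` S_flow \<phi>"
  then obtain R where "R \<in> S_flow \<phi>" "\<alpha> = rho_flow \<phi> R" by blast
  then obtain B c \<beta> where "\<alpha> = rho_flow \<phi> (affine_torus B c)" and B: "invertible B" "real_matrix B *v a = \<beta> *\<^sub>R a"
    unfolding S_flow_iff by blast
  then have "\<alpha> = nu_flow \<phi> B" using rho_flow_affine[OF B] nu_flow_eq[OF B] by simp
  moreover have "B \<in> Pi_flow \<phi>" using B Pi_flow_iff by blast
  ultimately show "\<alpha> \<in> nu_flow \<phi> ` Pi_flow \<phi>" by (rule image_eqI)
next
  fix \<alpha> assume "\<alpha> \<in> nu_flow \<phi> ` Pi_flow \<phi>"
  then obtain B where "B \<in> Pi_flow \<phi>" "\<alpha> = nu_flow \<phi> B" by blast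
  then obtain \<beta> where "\<alpha> = nu_flow \<phi> B" and B: "invertible B" "real_matrix B *v a = \<beta> *\<^sub>R a"
    unfolding Pi_flow_iff by blast
  then have "\<alpha> = rho_flow \<phi> (affine_torus B 0)"
    using rho_flow_affine[OF B, of 0] nu_flow_eq[OF B] by simp
  moreover have "affine_torus B 0 \<in> S_flow \<phi>" using B S_flow_iff by blast
  ultimately show "\<alpha> \<in> rho_flow \<phi> ` S_flow \<phi>" by (rule image_eqI)
qed

lemma inj_on_nu_flow: "inj_on (nu_flow \<phi>) (Pi_flow \<phi>)"
proof (rule inj_onI)
  fix A B assume AB: "A \<in> Pi_flow \<phi>" "B \<in> Pi_flow \<phi>" "nu_flow \<phi> A = nu_flow \<phi> B"
  have "real_matrix A *v a = real_matrix B *v a"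
    unfolding AB(1,2)[THEN nu_flow_eigenvalue] AB(3) ..
  then show "A = B" by (rule matrix_eq_if_agree_on_direction)
qed

section \<open>Group structure of \<open>Pi_flow\<close>\<close>

lemma Pi_flow_mult:
  assumes "A \<in> Pi_flow \<phi>" "B \<in> Pi_flow \<phi>"
  shows "A ** B \<in> Pi_flow \<phi>" "nu_flow \<phi> (A ** B) = nu_flow \<phi> A * nu_flow \<phi> B"
proof -
  \<comment> \<open>All members share the eigenvector \<open>a\<close>, so their eigenvalues
    multiply.\<close>
  have "real_matrix (A ** B) *v a = real_matrix A *v (real_matrix B *v a)"
    by (simp only: real_matrix_mult matrix_vector_mul_assoc)
  also have "\<dots> = (nu_flow \<phi> A * nu_flow \<phi> B) *\<^sub>R a"
    by (simp only: assms[THEN nu_flow_eigenvalue] matrix_vector_mult_scaleR scaleR_scaleR mult.commute)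
  finally have eigen: "real_matrix (A ** B) *v a = (nu_flow \<phi> A * nu_flow \<phi> B) *\<^sub>R a" .
  have "invertible (A ** B)" using assms by (simp add: Pi_flow_iff invertible_mult)
  then show "A ** B \<in> Pi_flow \<phi>" "nu_flow \<phi> (A ** B) = nu_flow \<phi> A * nu_flow \<phi> B"
    using eigen nu_flow_eq[OF _ eigen] Pi_flow_iff by blast+
qed

lemma subgroup_Pi_flow: "subgroup (Pi_flow \<phi>) GL_int"
proof (rule group.subgroupI[OF group_GL_int])
  show "Pi_flow \<phi> \<subseteq> carrier GL_int" by (auto simp: Pi_flow_def)
  have "mat 1 \<in> Pi_flow \<phi>"
    by (auto simp: Pi_flow_iff real_matrix_one invertible_mat_one intro: exI[of _ 1])
  then show "Pi_flow \<phi> \<noteq> {}" by blast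
next
  fix B assume B: "B \<in> Pi_flow \<phi>"
  then obtain A where A: "A ** B = mat 1" "B ** A = mat 1" by (auto simp: Pi_flow_iff invertible_def)
  have "inv\<^bsub>GL_int\<^esub> B = A"
    using A by (intro group.inv_equality[OF group_GL_int]) (auto simp: GL_int_def invertible_def)
  \<comment> \<open>The inverse matrix has the reciprocal eigenvalue, again at
    \<open>a\<close>.\<close>
  moreover have "nu_flow \<phi> B *\<^sub>R (real_matrix A *v a) = a"
  proof -
    have "nu_flow \<phi> B *\<^sub>R (real_matrix A *v a) = real_matrix A *v (real_matrix B *v a)"
      using B by (simp add: nu_flow_eigenvalue matrix_vector_mult_scaleR)
    also have "\<dots> = a"
      by (simp add: matrix_vector_mul_assoc real_matrix_one A flip: real_matrix_mult)
    finally show ?thesis .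
  qed
  then have "real_matrix A *v a = inverse (nu_flow \<phi> B) *\<^sub>R a"
    using nu_flow_nonzero[OF B] by (metis inverse_nonzero_iff_nonzero left_inverse scaleR_one scaleR_scaleR)
  ultimately show "inv\<^bsub>GL_int\<^esub> B \<in> Pi_flow \<phi>"
    using A by (auto simp: Pi_flow_iff invertible_def)
next
  fix A B assume "A \<in> Pi_flow \<phi>" "B \<in> Pi_flow \<phi>"
  then show "A \<otimes>\<^bsub>GL_int\<^esub> B \<in> Pi_flow \<phi>" by (simp add: GL_int_def Pi_flow_mult)
qed

text \<open>The target is the full multiplicative group of the reals, so that the image comes out as
  a subgroup of it.\<close>

lemma group_hom_nu_flow: "group_hom (GL_int\<lparr>carrier := Pi_flow \<phi>\<rparr>) mult_group_real (nu_flow \<phi>)"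
  using group.subgroup_imp_group[OF group_GL_int subgroup_Pi_flow]
    comm_group.axioms(2)[OF comm_group_mult_group_real]
  by (auto simp: group_hom_def group_hom_axioms_def hom_def GL_int_def mult_group_real_def
      nu_flow_nonzero Pi_flow_mult)

end

theorem theorem5p3:
  fixes a :: "real ^ 'n::finite"
    and X :: "'n torus \<Rightarrow> real ^ 'n"
    and \<phi> :: "real \<Rightarrow> 'n torus \<Rightarrow> 'n torus"
  assumes "CARD('n) \<ge> 2"
    and "rationally_independent a"
    and "X = (\<lambda>p. a)"
    and "generates_flow X \<phi>"
  shows "subgroup (rho_flow \<phi> ` S_flow \<phi>) mult_group_real \<and>
         subgroup (Pi_flow \<phi>) GL_int \<and>
         nu_flow \<phi> \<in> iso (GL_int\<lparr>carrier := Pi_flow \<phi>\<rparr>)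
                          (mult_group_real\<lparr>carrier := rho_flow \<phi> ` S_flow \<phi>\<rparr>) \<and>
         comm_group (GL_int\<lparr>carrier := Pi_flow \<phi>\<rparr>)"
proof -
  interpret irrational_flow a \<phi> using assms by unfold_locales auto
  interpret nu: group_hom "GL_int\<lparr>carrier := Pi_flow \<phi>\<rparr>" mult_group_real "nu_flow \<phi>"
    by (rule group_hom_nu_flow)
  have "subgroup (rho_flow \<phi> ` S_flow \<phi>) mult_group_real"
    using nu.img_is_subgroup by (simp add: rho_image)
  moreover have "nu_flow \<phi> \<in> iso (GL_int\<lparr>carrier := Pi_flow \<phi>\<rparr>)
      (mult_group_real\<lparr>carrier := rho_flow \<phi> ` S_flow \<phi>\<rparr>)"
    using nu.homh inj_on_nu_flow by (simp add: iso_def hom_def rho_image bij_betw_def Pi_def)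
  moreover have "comm_group (GL_int\<lparr>carrier := Pi_flow \<phi>\<rparr>)"
  \<comment> \<open>Eigenvalues commute as real numbers, and injectivity of \<open>nu_flow\<close>
    pulls this back to the matrices.\<close>
  proof (rule nu.G.group_comm_groupI)
    fix A B assume AB: "A \<in> carrier (GL_int\<lparr>carrier := Pi_flow \<phi>\<rparr>)"
      "B \<in> carrier (GL_int\<lparr>carrier := Pi_flow \<phi>\<rparr>)"
    then have "nu_flow \<phi> (A ** B) = nu_flow \<phi> (B ** A)"
      by (simp add: Pi_flow_mult mult.commute)
    then show "A \<otimes>\<^bsub>GL_int\<lparr>carrier := Pi_flow \<phi>\<rparr>\<^esub> B = B \<otimes>\<^bsub>GL_int\<lparr>carrier := Pi_flow \<phi>\<rparr>\<^esub> A"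
      using AB inj_onD[OF inj_on_nu_flow] by (simp add: GL_int_def Pi_flow_mult)
  qed
  ultimately show ?thesis using subgroup_Pi_flow by blast
qed

end
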